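(* For every three-valued scheme $\mathbf{X}$, $\vDash^{ts}_{\mathbf{X}} \ \neq\ \vDash_2$.
   Context: Language: $P$ is a denumerable (countably infinite) set of propositional variables, and $\mathcal{L}$ is the set of formulae generated from $P$ by the connectives $\neg$ (unary), $\wedge$, $\vee$ (binary). $\Gamma,\Delta$ range over arbitrary sets of formulae; a consequence relation is a set of pairs $(\Gamma,\Delta)$. Classical consequence $\vDash_2$: $\Gamma\vDash_2\Delta$ iff for every $v:\mathcal{L}\to\{0,1\}$ with $v(\neg A)=1-v(A)$, $v(A\wedge B)=\min(v(A),v(B))$, $v(A\vee B)=\max(v(A),v(B))$: if $v(A)=1$ for every $A\in\Gamma$, then $v(B)=1$ for some $B\in\Delta$. A three-valued scheme is a triple $\mathbf{X}=(f_\neg,f_\wedge,f_\vee)$ of operations on $\{1,\tfrac12,0\}$ (of arity $1,2,2$). An $\mathbf{X}$-valuation is a map $v:\mathcal{L}\to\{1,\tfrac12,0\}$ with $v(\neg A)=f_\neg(v(A))$, $v(A\wedge B)=f_\wedge(v(A),v(B))$, $v(A\vee B)=f_\vee(v(A),v(B))$. $\Gamma\vDash^{ts}_{\mathbf{X}}\Delta$ iff for every $\mathbf{X}$-valuation $v$: if $v(A)\in\{1,\tfrac12\}$ for every $A\in\Gamma$, then $v(B)=1$ for some $B\in\Delta$. *)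

theory Defs
  imports "HOL-Library.Countable_Set"
begin

datatype 'p fm =
    Atom 'p
  | Neg "'p fm"
  | Conj "'p fm" "'p fm"
  | Disj "'p fm" "'p fm"

definition boolean_valuation :: "('p fm \<Rightarrow> int) \<Rightarrow> bool" where
  "boolean_valuation v \<longleftrightarrow>
     (\<forall>A. v A \<in> {0, 1}) \<and>
     (\<forall>A. v (Neg A) = 1 - v A) \<and>
     (\<forall>A B. v (Conj A B) = min (v A) (v B)) \<and>
     (\<forall>A B. v (Disj A B) = max (v A) (v B))"

definition classical_consequence :: "('p fm set \<times> 'p fm set) set" where
  "classical_consequence =
     {(\<Gamma>, \<Delta>). \<forall>v. boolean_valuation v \<longrightarrow>
        (\<forall>A\<in>\<Gamma>. v A = 1) \<longrightarrow> (\<exists>B\<in>\<Delta>. v B = 1)}"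

datatype tv = One | Half | Zero

record scheme =
  f_neg :: "tv \<Rightarrow> tv"
  f_conj :: "tv \<Rightarrow> tv \<Rightarrow> tv"
  f_disj :: "tv \<Rightarrow> tv \<Rightarrow> tv"

definition valuation :: "scheme \<Rightarrow> ('p fm \<Rightarrow> tv) \<Rightarrow> bool" where
  "valuation X v \<longleftrightarrow>
     (\<forall>A. v (Neg A) = f_neg X (v A)) \<and>
     (\<forall>A B. v (Conj A B) = f_conj X (v A) (v B)) \<and>
     (\<forall>A B. v (Disj A B) = f_disj X (v A) (v B))"

definition ts_consequence :: "scheme \<Rightarrow> ('p fm set \<times> 'p fm set) set" where
  "ts_consequence X =
     {(\<Gamma>, \<Delta>). \<forall>v. valuation X v \<longrightarrow>
        (\<forall>A\<in>\<Gamma>. v A \<in> {One, Half}) \<longrightarrow> (\<exists>B\<in>\<Delta>. v B = One)}"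

end

theory Submission
  imports Defs
begin

text \<open>
  The two relations already differ on reflexivity. Classically every formula entails itself.
  The ts-relation demands strictly more of a conclusion (value \<^const>\<open>One\<close>) than of a premise
  (value \<^const>\<open>One\<close> or \<^const>\<open>Half\<close>), so a formula that takes the value \<^const>\<open>Half\<close> in some
  valuation does not entail itself. An atom is such a formula whatever the scheme, because a
  scheme constrains only compound formulae.
\<close>

primrec extend_assignment :: "scheme \<Rightarrow> ('p \<Rightarrow> tv) \<Rightarrow> 'p fm \<Rightarrow> tv" where
  "extend_assignment X h (Atom p) = h p"
| "extend_assignment X h (Neg A) = f_neg X (extend_assignment X h A)"
| "extend_assignment X h (Conj A B) =
     f_conj X (extend_assignment X h A) (extend_assignment X h B)"
| "extend_assignment X h (Disj A B) =
     f_disj X (extend_assignment X h A) (extend_assignment X h B)"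

lemma valuation_extend_assignment: "valuation X (extend_assignment X h)"
  by (simp add: valuation_def)

lemma classical_consequence_refl: "({A}, {A}) \<in> classical_consequence"
  by (simp add: classical_consequence_def)

text \<open>
  The constant assignment \<^const>\<open>Half\<close> makes the atom good enough as a premise but not as a
  conclusion.
\<close>

lemma ts_consequence_atom_not_refl: "({Atom p}, {Atom p}) \<notin> ts_consequence X"
proof -
  let ?v = "extend_assignment X (\<lambda>_. Half)"
  have "valuation X ?v" "?v (Atom p) = Half"
    by (simp_all add: valuation_extend_assignment)
  then show ?thesis
    unfolding ts_consequence_def by force
qed

theorem theorem3p1:
  fixes X :: scheme
  assumes "countable (UNIV :: 'p set)" and "infinite (UNIV :: 'p set)"
  shows "ts_consequence X \<noteq> (classical_consequence :: ('p fm set \<times> 'p fm set) set)"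
  using classical_consequence_refl ts_consequence_atom_not_refl by metis

end
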